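(* Let $\mathcal{X}$ be a complete and separable metric space, $\nu$ a diffuse (non-atomic) measure on $\mathcal{X}$ which is the mean measure of a Poisson process, and $g_1,\dots,g_n$ non-negative functions in $BM(\mathcal{X})$, the collection of measurable functions of bounded support on $\mathcal{X}$. Then the $n$-step seating algorithm (described in the context) results in a random partition $\mathbf{p}=\{C_1,\dots,C_{n(\mathbf{p})}\}$ of $\{1,\dots,n\}$ drawn from a distribution $q(\mathbf{p}|\mathbf{g})$ that satisfies $$\mathcal{I}(\mathbf{p}|\mathbf{g})\,q(\mathbf{p}|\mathbf{g})=\prod_{j=1}^{n(\mathbf{p})}\int_{\mathcal{X}}\Big[\prod_{i\in C_j}g_i(x)\Big]\nu(dx),\qquad \mathcal{I}(\mathbf{p}|\mathbf{g})=\prod_{r=1}^{n}l(r-1),$$ where $l(r-1)$ is evaluated at the restriction $\mathbf{p}_{r-1}$ of $\mathbf{p}$ to $\{1,\dots,r-1\}$.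
   Context: For a nonempty set $C$ of indices put $\pi_g(dx|C)=\frac{[\prod_{i\in C}g_i(x)]\nu(dx)}{\int_{\mathcal{X}}[\prod_{i\in C}g_i(u)]\nu(du)}$. For a partition $\mathbf{p}_r=\{C_{1,r},\dots,C_{n(\mathbf{p}_r),r}\}$ of $\{1,\dots,r\}$ put $l(r)=\int_{\mathcal{X}}g_{r+1}(x)\nu(dx)+\sum_{i=1}^{n(\mathbf{p}_r)}\int_{\mathcal{X}}g_{r+1}(x)\pi_g(dx|C_{i,r})$ (with no sum for $r=0$). Seating algorithm: Step 1: customer 1 sits at a table (with probability $l(0)/l(0)=1$), so $\mathbf{p}_1=\{\{1\}\}$. Step $r+1$ ($1\le r\le n-1$): given $\mathbf{p}_r$, customer $r+1$ joins the existing table $C_{j,r}$ with probability $l(r)^{-1}\int g_{r+1}(x)\pi_g(dx|C_{j,r})$, $j=1,\dots,n(\mathbf{p}_r)$, and otherwise sits at a new table, with probability $l(r)^{-1}\int g_{r+1}(x)\nu(dx)$. The tables after step $n$ form $\mathbf{p}=\mathbf{p}_n$.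
   Formalization: The formal theorem also assumes that for every nonempty subset C of {1,…,n} the product of the g_i, i in C, is ν-integrable; without this the quantities l(r) and the seating probabilities may be infinite or undefined. *)

theory Defs
  imports "HOL-Probability.Probability" "HOL-Library.Disjoint_Sets"
begin

definition diffuse :: "'a::topological_space measure \<Rightarrow> bool" where
  "diffuse \<nu> \<longleftrightarrow> (\<forall>x. emeasure \<nu> {x} = 0)"

text \<open>
  \<open>N\<close> is a Poisson process on the Borel space of \<open>'a\<close>, carried by the probability space \<open>\<Omega>\<close>, with
  mean measure \<open>\<nu>\<close>: a random counting measure with \<open>E[N(A)] = \<nu>(A)\<close>, whose counts \<open>N(A)\<close> are
  Poisson with parameter \<open>\<nu>(A)\<close> (infinite almost surely if \<open>\<nu>(A) = \<infinity>\<close>), independent over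
  pairwise disjoint sets.  The Poisson weights are written out because \<open>poisson_pmf\<close> excludes
  parameter \<open>0\<close>.
\<close>

definition poisson_process ::
    "'w measure \<Rightarrow> ('w \<Rightarrow> 'a::topological_space measure) \<Rightarrow> 'a measure \<Rightarrow> bool" where
  "poisson_process \<Omega> N \<nu> \<longleftrightarrow>
     prob_space \<Omega> \<and> sets \<nu> = sets borel \<and>
     (\<forall>\<omega>\<in>space \<Omega>. sets (N \<omega>) = sets borel \<and>
        (\<forall>A\<in>sets borel. emeasure (N \<omega>) A \<in> insert \<infinity> (range of_nat))) \<and>
     (\<forall>A\<in>sets borel. (\<lambda>\<omega>. emeasure (N \<omega>) A) \<in> borel_measurable \<Omega>) \<and>
     (\<forall>A\<in>sets borel. emeasure \<nu> A = (\<integral>\<^sup>+\<omega>. emeasure (N \<omega>) A \<partial>\<Omega>)) \<and>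
     (\<forall>A\<in>sets borel. emeasure \<nu> A < \<infinity> \<longrightarrow>
        (\<forall>k::nat. measure \<Omega> {\<omega>\<in>space \<Omega>. emeasure (N \<omega>) A = of_nat k} =
                  exp (- measure \<nu> A) * measure \<nu> A ^ k / fact k)) \<and>
     (\<forall>A\<in>sets borel. emeasure \<nu> A = \<infinity> \<longrightarrow> (AE \<omega> in \<Omega>. emeasure (N \<omega>) A = \<infinity>)) \<and>
     (\<forall>(I::nat set) A. finite I \<and> (\<forall>i\<in>I. A i \<in> sets borel) \<and> disjoint_family_on A I \<longrightarrow>
        prob_space.indep_vars \<Omega> (\<lambda>_. borel) (\<lambda>i \<omega>. emeasure (N \<omega>) (A i)) I)"

definition BM :: "('a::metric_space \<Rightarrow> real) set" where
  "BM = {f \<in> borel_measurable borel. bounded {x. f x \<noteq> 0}}"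

definition pi_g :: "'a measure \<Rightarrow> (nat \<Rightarrow> 'a \<Rightarrow> real) \<Rightarrow> nat set \<Rightarrow> 'a measure" where
  "pi_g \<nu> g C = density \<nu> (\<lambda>x. ennreal ((\<Prod>i\<in>C. g i x) / (LINT u|\<nu>. (\<Prod>i\<in>C. g i u))))"

definition seat_norm :: "'a measure \<Rightarrow> (nat \<Rightarrow> 'a \<Rightarrow> real) \<Rightarrow> nat \<Rightarrow> nat set set \<Rightarrow> real" where
  "seat_norm \<nu> g r P =
     (LINT x|\<nu>. g (Suc r) x) + (\<Sum>C\<in>P. LINT x|pi_g \<nu> g C. g (Suc r) x)"

text \<open>
  The choice of customer \<open>r + 1\<close> given the partition \<open>P\<close> of \<open>{1..r}\<close>: \<open>Some C\<close> is the existing table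
  \<open>C\<close>, \<open>None\<close> a new table.  If \<open>l(r) = 0\<close>, the prescribed probabilities are all \<open>0/0\<close>; the customer
  then sits at a new table, so that \<open>l(0)/l(0)\<close> is always read as \<open>1\<close>.
\<close>

definition seating_weight ::
    "'a measure \<Rightarrow> (nat \<Rightarrow> 'a \<Rightarrow> real) \<Rightarrow> nat \<Rightarrow> nat set set \<Rightarrow> nat set option \<Rightarrow> real" where
  "seating_weight \<nu> g r P c =
     (case c of
        None \<Rightarrow> (LINT x|\<nu>. g (Suc r) x) / seat_norm \<nu> g r P
      | Some C \<Rightarrow> if C \<in> P then (LINT x|pi_g \<nu> g C. g (Suc r) x) / seat_norm \<nu> g r P else 0)"

definition seating_choice ::
    "'a measure \<Rightarrow> (nat \<Rightarrow> 'a \<Rightarrow> real) \<Rightarrow> nat \<Rightarrow> nat set set \<Rightarrow> nat set option pmf" where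
  "seating_choice \<nu> g r P =
     (if seat_norm \<nu> g r P = 0 then return_pmf None else embed_pmf (seating_weight \<nu> g r P))"

fun seat :: "nat \<Rightarrow> nat set set \<Rightarrow> nat set option \<Rightarrow> nat set set" where
  "seat k P None = insert {k} P"
| "seat k P (Some C) = insert (insert k C) (P - {C})"

primrec seating_pmf :: "'a measure \<Rightarrow> (nat \<Rightarrow> 'a \<Rightarrow> real) \<Rightarrow> nat \<Rightarrow> nat set set pmf" where
  "seating_pmf \<nu> g 0 = return_pmf {}"
| "seating_pmf \<nu> g (Suc r) =
     bind_pmf (seating_pmf \<nu> g r) (\<lambda>P. map_pmf (seat (Suc r) P) (seating_choice \<nu> g r P))"

definition restrict_partition :: "nat set set \<Rightarrow> nat \<Rightarrow> nat set set" where
  "restrict_partition p r = (\<lambda>C. C \<inter> {1..r}) ` p - {{}}"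

definition seating_I :: "'a measure \<Rightarrow> (nat \<Rightarrow> 'a \<Rightarrow> real) \<Rightarrow> nat \<Rightarrow> nat set set \<Rightarrow> real" where
  "seating_I \<nu> g n p = (\<Prod>r=1..n. seat_norm \<nu> g (r - 1) (restrict_partition p (r - 1)))"

text \<open>The seating weights are probabilities, so \<open>embed_pmf\<close> has its intended meaning.\<close>

lemma pmf_seating_choice:
  assumes P: "finite P" and nn: "\<And>x. 0 \<le> g (Suc r) x" and l: "seat_norm \<nu> g r P \<noteq> 0"
  shows "pmf (seating_choice \<nu> g r P) c = seating_weight \<nu> g r P c"
proof -
  let ?w = "seating_weight \<nu> g r P" and ?l = "seat_norm \<nu> g r P"
  have l0: "?l \<ge> 0"
    unfolding seat_norm_def by (intro add_nonneg_nonneg sum_nonneg integral_nonneg_AE) (auto simp: nn)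
  have w0: "?w c \<ge> 0" for c
    using l0 nn by (auto simp: seating_weight_def split: option.split intro!: divide_nonneg_nonneg integral_nonneg_AE)
  let ?S = "insert None (Some ` P)"
  have "(\<integral>\<^sup>+c. ennreal (?w c) \<partial>count_space UNIV) = (\<integral>\<^sup>+c. ennreal (?w c) * indicator ?S c \<partial>count_space UNIV)"
    by (intro nn_integral_cong) (auto simp: seating_weight_def indicator_def split: option.split)
  also have "\<dots> = (\<Sum>c\<in>?S. ennreal (?w c))"
    using P by (simp add: nn_integral_count_space_indicator[symmetric] nn_integral_count_space_finite)
  also have "\<dots> = ennreal (\<Sum>c\<in>?S. ?w c)"
    using w0 by (intro sum_ennreal) auto
  also have "(\<Sum>c\<in>?S. ?w c) = ?w None + (\<Sum>C\<in>P. ?w (Some C))"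
    using P by (subst sum.insert) (auto simp: sum.reindex)
  also have "\<dots> = ?l / ?l"
    unfolding seat_norm_def add_divide_distrib sum_divide_distrib
    by (simp add: seating_weight_def seat_norm_def)
  finally have "(\<integral>\<^sup>+c. ennreal (?w c) \<partial>count_space UNIV) = 1"
    using l by simp
  then show ?thesis
    using l w0 by (simp add: seating_choice_def pmf_embed_pmf)
qed

text \<open>
  If functions in \<open>BM\<close> are in addition required to be bounded and \<open>\<nu>\<close> is boundedly finite, all the
  products that the seating algorithm integrates are integrable.
\<close>

lemma integrable_prod_BM:
  fixes \<nu> :: "'a::metric_space measure"
  assumes sets: "sets \<nu> = sets borel"
    and fin: "\<And>A. A \<in> sets borel \<Longrightarrow> bounded A \<Longrightarrow> emeasure \<nu> A < \<infinity>"
    and BM: "\<And>i. i \<in> C \<Longrightarrow> g i \<in> BM" and bdd: "\<And>i. i \<in> C \<Longrightarrow> bounded (range (g i))"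
    and C: "finite C" "C \<noteq> {}"
  shows "integrable \<nu> (\<lambda>x. \<Prod>i\<in>C. g i x)"
proof -
  have meas[measurable]: "g i \<in> borel_measurable borel" if "i \<in> C" for i
    using BM[OF that] by (simp add: BM_def)
  obtain j where j: "j \<in> C" using C by blast
  let ?S = "{x. g j x \<noteq> 0}"
  have S: "?S \<in> sets borel" "bounded ?S"
    using BM[OF j] meas[OF j] by (auto simp: BM_def)
  have "\<forall>i\<in>C. \<exists>b. \<forall>x. \<bar>g i x\<bar> \<le> b"
    using bdd by (auto simp: bounded_iff)
  then obtain b where b: "\<And>i x. i \<in> C \<Longrightarrow> \<bar>g i x\<bar> \<le> b i" by metis
  have le: "\<bar>\<Prod>i\<in>C. g i x\<bar> \<le> (\<Prod>i\<in>C. b i) * indicator ?S x" for x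
  proof (cases "x \<in> ?S")
    case True
    have "\<bar>\<Prod>i\<in>C. g i x\<bar> = (\<Prod>i\<in>C. \<bar>g i x\<bar>)" by (rule abs_prod)
    also have "\<dots> \<le> (\<Prod>i\<in>C. b i)" using b by (intro prod_mono) auto
    finally show ?thesis using True by simp
  next
    case False
    then have "(\<Prod>i\<in>C. g i x) = 0" using j C by auto
    with False show ?thesis by simp
  qed
  have bint: "integrable \<nu> (\<lambda>x. (\<Prod>i\<in>C. b i) * indicator ?S x)"
    using S fin[OF S] sets by (intro integrable_mult_right integrable_real_indicator) auto
  have "(\<lambda>x. \<Prod>i\<in>C. g i x) \<in> borel_measurable \<nu>"
    using meas by (intro borel_measurable_prod) (simp add: measurable_cong_sets[OF sets refl])
  then show ?thesis
    by (rule Bochner_Integration.integrable_bound[OF bint])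
       (use le in \<open>auto intro!: AE_I2 intro: order_trans[OF _ abs_ge_self]\<close>)
qed

end

(* Join one customer at a time. With m(C) the integral of the product of the g_i, i in C, every
   table C satisfies m(C) * (integral of g_{r+1} against pi_g(.|C)) = m(C + {r+1}), also when
   m(C) = 0. So seating customer r+1 multiplies the product of the m(C) by l(r) times the probability
   of the choice. A partition determines the choices that lead to it, hence it is reached along one
   path only, and multiplying along this path gives the formula. *)

theory Submission
  imports Defs
begin

section \<open>Seating a customer in a partition\<close>

text \<open>\<open>seating_choice\<close> lives on options of arbitrary sets of naturals. This is
  the finite range in which every actual choice lies; \<open>seat\<close> is well behaved only
  there.\<close>

definition choices :: "nat set set \<Rightarrow> nat set option set" where
  "choices P = insert None (Some ` P)"

lemma partition_on_remove:
  assumes P: "partition_on A P" and B: "B \<in> P"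
  shows "partition_on (A - B) (P - {B})"
proof -
  have "disjnt B (\<Union>(P - {B}))"
    using P B by (auto simp: partition_on_def disjoint_def disjnt_def)
  moreover have "partition_on A (insert B (P - {B}))"
    using P B by (simp add: insert_absorb)
  ultimately show ?thesis using partition_on_insert by blast
qed

lemma partition_on_seat:
  assumes P: "partition_on A P" and k: "k \<notin> A" and c: "c \<in> choices P"
  shows "partition_on (insert k A) (seat k P c)"
proof (cases c)
  case None
  have "disjnt {k} (\<Union>P)" using P k by (simp add: partition_on_def)
  with None P k show ?thesis by (simp add: partition_on_insert)
next
  case (Some C)
  with c have C: "C \<in> P" by (auto simp: choices_def)
  have CA: "C \<subseteq> A" using P C by (auto simp: partition_on_def)
  have rest: "partition_on (A - C) (P - {C})" using P C by (rule partition_on_remove)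
  then have "disjnt (insert k C) (\<Union>(P - {C}))"
    using k by (auto simp: partition_on_def disjnt_def)
  moreover have "insert k A - insert k C = A - C" using k by auto
  ultimately show ?thesis
    using Some rest CA by (auto simp: partition_on_insert)
qed

lemma restrict_partition_self:
  assumes "partition_on {1..r} P"
  shows "restrict_partition P r = P"
proof -
  have "C \<inter> {1..r} = C" if "C \<in> P" for C
    using assms that by (auto simp: partition_on_def)
  then have "(\<lambda>C. C \<inter> {1..r}) ` P = P" by simp
  then show ?thesis using assms by (auto simp: restrict_partition_def partition_on_def)
qed

lemma restrict_partition_restrict_partition:
  assumes "k \<le> m"
  shows "restrict_partition (restrict_partition p m) k = restrict_partition p k"
proof -
  have cut: "C \<inter> {1..m} \<inter> {1..k} = C \<inter> {1..k}" for C
    using assms by auto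
  \<comment> \<open>Dropping the empty block before the second cut is harmless, since it would be
    cut to the empty block and dropped anyway.\<close>
  have "(\<lambda>C. C \<inter> {1..k}) ` (A - {{}}) - {{}} = (\<lambda>C. C \<inter> {1..k}) ` A - {{}}" for A :: "nat set set"
    by auto
  then show ?thesis by (simp only: restrict_partition_def image_image cut)
qed

text \<open>Cutting erases \<open>Suc r\<close>: a new table becomes empty and is dropped, an
  enlarged one is cut back to the table joined. So the previous partition can be recovered from the
  result.\<close>

lemma restrict_partition_seat:
  assumes P: "partition_on {1..r} P" and c: "c \<in> choices P"
  shows "restrict_partition (seat (Suc r) P c) r = P"
proof -
  have "restrict_partition (seat (Suc r) P c) r = restrict_partition P r"
    using c by (cases c) (auto simp: choices_def restrict_partition_def)
  then show ?thesis using restrict_partition_self[OF P] by simp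
qed

text \<open>The choice can be read off from the table where \<open>k\<close> sits: it is
  \<open>{k}\<close> exactly for a new table, and otherwise removing \<open>k\<close> returns the
  table joined. Nonempty tables keep the two cases apart.\<close>

lemma inj_on_seat:
  assumes P: "partition_on A P" and k: "k \<notin> A"
  shows "inj_on (seat k P) (choices P)"
proof -
  define block where "block p = (THE B. B \<in> p \<and> k \<in> B)" for p :: "nat set set"
  define choice where "choice B = (if B = {k} then None else Some (B - {k}))" for B
  have k': "k \<notin> C" "C \<noteq> {}" if "C \<in> P" for C
    using P k that by (auto simp: partition_on_def)
  have "choice (block (seat k P c)) = c" if "c \<in> choices P" for c
  proof (cases c)
    case None
    then have "block (seat k P c) = {k}"
      unfolding block_def using k' by (auto intro!: the_equality)
    with None show ?thesis by (simp add: choice_def)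
  next
    case (Some C)
    with that have C: "C \<in> P" by (auto simp: choices_def)
    from Some have "block (seat k P c) = insert k C"
      unfolding block_def using k' by (auto intro!: the_equality)
    moreover have "insert k C \<noteq> {k}" "insert k C - {k} = C" using k'[OF C] by blast+
    ultimately show ?thesis using Some by (simp add: choice_def)
  qed
  then show ?thesis by (rule inj_on_inverseI)
qed

text \<open>Remove \<open>k\<close> from its block. If nothing is left, \<open>k\<close> opened a
  new table; otherwise the remainder is the table that \<open>k\<close> joined.\<close>

lemma partition_on_insert_cases:
  assumes p: "partition_on (insert k A) p" and k: "k \<notin> A"
  obtains P c where "partition_on A P" "c \<in> choices P" "p = seat k P c"
proof -
  obtain B where B: "B \<in> p" "k \<in> B"
    using p unfolding partition_on_def by blast
  have BA: "B \<subseteq> insert k A" using p B by (auto simp: partition_on_def)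
  have rest: "partition_on (insert k A - B) (p - {B})" using p B(1) by (rule partition_on_remove)
  show thesis
  proof (cases "B = {k}")
    case True
    then have "insert k A - B = A" using k by auto
    then show thesis
      using that[of "p - {B}" None] rest B True by (simp add: choices_def insert_absorb)
  next
    case False
    let ?D = "B - {k}"
    have D: "?D \<noteq> {}" using False B by blast
    have disj: "disjnt ?D (\<Union>(p - {B}))"
      using rest by (auto simp: partition_on_def disjnt_def)
    have "A - ?D = insert k A - B" using k B by auto
    then have part: "partition_on A (insert ?D (p - {B}))"
      using rest BA D by (auto simp: partition_on_insert[OF disj])
    \<comment> \<open>Otherwise \<open>seat\<close>, which deletes the joined table, would also
      delete another block of \<open>p\<close>.\<close>
    have notin: "?D \<notin> p - {B}" using disj D by (auto simp: disjnt_def)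
    have "seat k (insert ?D (p - {B})) (Some ?D) = insert B (p - {B})"
      using notin B by (simp add: insert_absorb)
    then show thesis
      using that[OF part, of "Some ?D"] B by (simp add: choices_def insert_absorb)
  qed
qed

section \<open>The mass of a choice\<close>

text \<open>The numerator of the probability of a choice, kept apart from the normaliser so that it
  still makes sense when the latter is 0.\<close>

definition choice_mass ::
    "'a measure \<Rightarrow> (nat \<Rightarrow> 'a \<Rightarrow> real) \<Rightarrow> nat \<Rightarrow> nat set option \<Rightarrow> real" where
  "choice_mass \<nu> g k c =
     (case c of None \<Rightarrow> LINT x|\<nu>. g k x | Some C \<Rightarrow> LINT x|pi_g \<nu> g C. g k x)"

lemma choice_mass_nonneg:
  assumes "\<And>x. 0 \<le> g k x"
  shows "0 \<le> choice_mass \<nu> g k c"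
  using assms by (auto simp: choice_mass_def split: option.split intro!: integral_nonneg_AE)

text \<open>The constant denominator of the density cancels if it is nonzero. If it is 0, the
  density degenerates to 0, but then the nonnegative product over \<open>C\<close> vanishes almost
  everywhere, hence so does the longer product, and both sides are 0.\<close>

lemma integral_pi_g:
  assumes C: "integrable \<nu> (\<lambda>x. \<Prod>i\<in>C. g i x)" and nn: "\<And>i x. i \<in> C \<Longrightarrow> 0 \<le> g i x"
    and meas: "g k \<in> borel_measurable \<nu>" and k: "finite C" "k \<notin> C"
  shows "(LINT x|pi_g \<nu> g C. g k x) * (LINT x|\<nu>. (\<Prod>i\<in>C. g i x))
    = (LINT x|\<nu>. (\<Prod>i\<in>insert k C. g i x))"
proof -
  let ?f = "\<lambda>x. \<Prod>i\<in>C. g i x"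
  let ?m = "LINT x|\<nu>. ?f x"
  have f0: "0 \<le> ?f x" for x using nn by (simp add: prod_nonneg)
  have m0: "0 \<le> ?m" using f0 by simp
  have [measurable]: "?f \<in> borel_measurable \<nu>" using C by simp
  have "(LINT x|pi_g \<nu> g C. g k x) = (LINT x|\<nu>. (?f x / ?m) *\<^sub>R g k x)"
    unfolding pi_g_def using meas f0 m0 by (intro integral_density) auto
  also have "\<dots> = (LINT x|\<nu>. (\<Prod>i\<in>insert k C. g i x) / ?m)"
    using k by (intro Bochner_Integration.integral_cong) (auto simp: mult.commute)
  also have "\<dots> = (LINT x|\<nu>. (\<Prod>i\<in>insert k C. g i x)) / ?m" by simp
  finally have eq: "(LINT x|pi_g \<nu> g C. g k x) = (LINT x|\<nu>. (\<Prod>i\<in>insert k C. g i x)) / ?m" .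
  show ?thesis
  proof (cases "?m = 0")
    case True
    then have "AE x in \<nu>. ?f x = 0"
      using integral_nonneg_eq_0_iff_AE[OF C] f0 by simp
    then have "AE x in \<nu>. (\<Prod>i\<in>insert k C. g i x) = 0" 
      by eventually_elim (use k in simp)
    then have "(LINT x|\<nu>. (\<Prod>i\<in>insert k C. g i x)) = 0"
      by (rule integral_eq_zero_AE)
    with True show ?thesis by simp
  next
    case False
    with eq show ?thesis by simp
  qed
qed

text \<open>Only one factor changes: a new table contributes the integral of \<open>g k\<close>, and
  joining \<open>C\<close> turns the factor of \<open>C\<close> into that of
  \<open>insert k C\<close>, by \<open>integral_pi_g\<close>.\<close>

lemma prod_seat:
  assumes P: "partition_on A P" and A: "finite A" and k: "k \<notin> A" and c: "c \<in> choices P"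
    and nn: "\<And>i x. i \<in> A \<Longrightarrow> 0 \<le> g i x"
    and int: "\<And>C. C \<subseteq> A \<Longrightarrow> C \<noteq> {} \<Longrightarrow> integrable \<nu> (\<lambda>x. \<Prod>i\<in>C. g i x)"
    and meas: "g k \<in> borel_measurable \<nu>"
  shows "(\<Prod>C\<in>seat k P c. LINT x|\<nu>. (\<Prod>i\<in>C. g i x))
    = choice_mass \<nu> g k c * (\<Prod>C\<in>P. LINT x|\<nu>. (\<Prod>i\<in>C. g i x))"
proof -
  have finP: "finite P" using finite_elements[OF A P] .
  have sub: "C \<subseteq> A" "C \<noteq> {}" if "C \<in> P" for C
    using P that by (auto simp: partition_on_def)
  \<comment> \<open>The table of \<open>k\<close> is not yet in \<open>P\<close>, so inserting it
    really adds a factor to the product over a set.\<close>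
  have notin: "insert k C \<notin> P" for C using sub k by auto
  show ?thesis
  proof (cases c)
    case None
    then show ?thesis using finP notin[of "{}"] by (simp add: choice_mass_def)
  next
    case (Some C)
    with c have C: "C \<in> P" by (auto simp: choices_def)
    have "(LINT x|pi_g \<nu> g C. g k x) * (LINT x|\<nu>. (\<Prod>i\<in>C. g i x))
        = (LINT x|\<nu>. (\<Prod>i\<in>insert k C. g i x))"
      using sub[OF C] k nn A by (intro integral_pi_g int meas) (auto intro: finite_subset)
    then show ?thesis
      using Some finP notin[of C]
      by (simp add: choice_mass_def prod.remove[OF finP C] mult.assoc[symmetric])
  qed
qed

lemma seat_norm_eq_sum:
  assumes "finite P"
  shows "seat_norm \<nu> g r P = (\<Sum>c\<in>choices P. choice_mass \<nu> g (Suc r) c)"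
  using assms by (simp add: seat_norm_def choices_def choice_mass_def sum.reindex)

lemma set_pmf_seating_choice:
  assumes P: "finite P" and nn: "\<And>x. 0 \<le> g (Suc r) x"
  shows "set_pmf (seating_choice \<nu> g r P) \<subseteq> choices P"
proof (cases "seat_norm \<nu> g r P = 0")
  case True
  then show ?thesis by (simp add: seating_choice_def choices_def)
next
  case False
  show ?thesis
  proof
    fix c assume "c \<in> set_pmf (seating_choice \<nu> g r P)"
    then have "seating_weight \<nu> g r P c \<noteq> 0"
      using pmf_seating_choice[where g = g and \<nu> = \<nu> and c = c, OF P nn False]
      by (simp add: set_pmf_iff)
    then show "c \<in> choices P"
      by (auto simp: seating_weight_def choices_def split: option.splits if_splits)
  qed
qed

text \<open>The product form survives the fallback to a new table: the normaliser is the sum of the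
  nonnegative masses of all choices, so if it is 0, every mass is 0.\<close>

lemma seat_norm_times_pmf_seating_choice:
  assumes P: "finite P" and nn: "\<And>x. 0 \<le> g (Suc r) x" and c: "c \<in> choices P"
  shows "seat_norm \<nu> g r P * pmf (seating_choice \<nu> g r P) c = choice_mass \<nu> g (Suc r) c"
proof (cases "seat_norm \<nu> g r P = 0")
  case True
  have "finite (choices P)" using P by (simp add: choices_def)
  moreover have "(\<Sum>c\<in>choices P. choice_mass \<nu> g (Suc r) c) = 0"
    using True seat_norm_eq_sum[OF P, of \<nu> g r] by simp
  ultimately have "choice_mass \<nu> g (Suc r) c = 0"
    using c nn by (simp add: sum_nonneg_eq_0_iff choice_mass_nonneg)
  with True show ?thesis by simp
next
  case False
  then show ?thesis
    using c pmf_seating_choice[where g = g and \<nu> = \<nu> and c = c, OF P nn False]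
    by (auto simp: seating_weight_def choice_mass_def choices_def)
qed

section \<open>The law of the seating\<close>

text \<open>Within the support, the fibre over \<open>f x\<close> contains at most \<open>x\<close>.
  The superset \<open>A\<close> admits an \<open>x\<close> of probability 0, as needed for available
  choices that are never taken.\<close>

lemma pmf_map_inj_on_superset:
  assumes "inj_on f A" and "set_pmf M \<subseteq> A" and "x \<in> A"
  shows "pmf (map_pmf f M) (f x) = pmf M x"
proof -
  have "f -` {f x} \<inter> set_pmf M = {x} \<inter> set_pmf M"
    using assms by (auto dest: inj_onD)
  then have "measure M (f -` {f x}) = measure M {x}"
    by (metis measure_Int_set_pmf)
  then show ?thesis by (simp add: pmf_map pmf.rep_eq)
qed

lemma set_pmf_seating_pmf:
  assumes nn: "\<And>i x. i \<in> {1..n} \<Longrightarrow> 0 \<le> g i x"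
  shows "set_pmf (seating_pmf \<nu> g n) \<subseteq> {p. partition_on {1..n} p}"
  using nn
proof (induction n)
  case 0
  show ?case by (simp add: partition_on_def)
next
  case (Suc r)
  have nn: "0 \<le> g (Suc r) x" for x using Suc.prems by simp
  have "partition_on {1..Suc r} (seat (Suc r) P c)"
    if P: "P \<in> set_pmf (seating_pmf \<nu> g r)" and c: "c \<in> set_pmf (seating_choice \<nu> g r P)" for P c
  proof -
    have part: "partition_on {1..r} P" using P Suc by auto
    then have "c \<in> choices P"
      using c set_pmf_seating_choice[where g = g and \<nu> = \<nu> and r = r, OF _ nn] finite_elements by blast
    then have "partition_on (insert (Suc r) {1..r}) (seat (Suc r) P c)"
      using part by (intro partition_on_seat) auto
    then show ?thesis by (simp add: atLeastAtMostSuc_conv)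
  qed
  then show ?case by auto
qed

text \<open>The expectation over the previous partition collapses to the single term
  \<open>P\<close>, the only possible predecessor; given \<open>P\<close>, injectivity of
  \<open>seat\<close> singles out \<open>c\<close>.\<close>

lemma pmf_seating_pmf_Suc:
  assumes nn: "\<And>i x. i \<in> {1..Suc r} \<Longrightarrow> 0 \<le> g i x"
    and P: "partition_on {1..r} P" and c: "c \<in> choices P"
  shows "pmf (seating_pmf \<nu> g (Suc r)) (seat (Suc r) P c)
    = pmf (seating_pmf \<nu> g r) P * pmf (seating_choice \<nu> g r P) c"
proof -
  let ?M = "seating_pmf \<nu> g r" and ?k = "Suc r"
  let ?h = "\<lambda>Q. pmf (map_pmf (seat ?k Q) (seating_choice \<nu> g r Q)) (seat ?k P c)"
  have choices: "set_pmf (seating_choice \<nu> g r Q) \<subseteq> choices Q" if "partition_on {1..r} Q" for Q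
    using that nn finite_elements by (intro set_pmf_seating_choice) auto
  \<comment> \<open>A nonzero term means that some choice leads from \<open>Q\<close> to the same
    partition; restricting both descriptions to \<open>{1..r}\<close> gives
    \<open>Q = P\<close>.\<close>
  have unique: "Q = P" if Q: "Q \<in> set_pmf ?M" "?h Q \<noteq> 0" for Q
  proof -
    have part: "partition_on {1..r} Q"
      using Q(1) nn set_pmf_seating_pmf[of r g \<nu>] by auto
    from Q(2) have "seat ?k P c \<in> seat ?k Q ` set_pmf (seating_choice \<nu> g r Q)"
      unfolding set_map_pmf[symmetric] set_pmf_iff .
    then obtain d where d: "d \<in> choices Q" "seat ?k P c = seat ?k Q d"
      using choices[OF part] by auto
    then show ?thesis
      using restrict_partition_seat[OF part d(1)] restrict_partition_seat[OF P c] by simp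
  qed
  have "pmf (seating_pmf \<nu> g ?k) (seat ?k P c) = (LINT Q|?M. ?h Q)"
    by (simp add: pmf_bind)
  also have "\<dots> = (\<Sum>Q\<in>{P}. ?h Q * pmf ?M Q)"
    using unique by (intro integral_measure_pmf_real) auto
  finally show ?thesis
    using pmf_map_inj_on_superset[OF inj_on_seat[OF P] choices[OF P] c, of ?k] by simp
qed

text \<open>Factor \<open>j\<close> looks only at the first \<open>j - 1\<close> customers. Hence
  the first \<open>r\<close> factors do not see customer \<open>Suc r\<close>, and the last one is
  evaluated at \<open>P\<close> itself.\<close>

lemma seating_I_Suc:
  assumes P: "partition_on {1..r} P" and c: "c \<in> choices P"
  shows "seating_I \<nu> g (Suc r) (seat (Suc r) P c) = seating_I \<nu> g r P * seat_norm \<nu> g r P"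
proof -
  let ?p = "seat (Suc r) P c"
  have restr: "restrict_partition ?p j = restrict_partition P j" if "j \<le> r" for j
    using restrict_partition_restrict_partition[OF that, of ?p] restrict_partition_seat[OF P c] by simp
  have "(\<Prod>j=1..r. seat_norm \<nu> g (j - 1) (restrict_partition ?p (j - 1))) = seating_I \<nu> g r P"
    unfolding seating_I_def by (intro prod.cong) (auto simp: restr)
  moreover have "restrict_partition ?p r = P"
    using restrict_partition_seat[OF P c] .
  ultimately show ?thesis
    by (simp add: seating_I_def prod.nat_ivl_Suc')
qed

lemma seating_I_times_pmf_seating_pmf:
  assumes "\<And>i x. i \<in> {1..n} \<Longrightarrow> 0 \<le> g i x"
    and "\<And>C. C \<subseteq> {1..n} \<Longrightarrow> C \<noteq> {} \<Longrightarrow> integrable \<nu> (\<lambda>x. \<Prod>i\<in>C. g i x)"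
    and "partition_on {1..n} p"
  shows "seating_I \<nu> g n p * pmf (seating_pmf \<nu> g n) p = (\<Prod>C\<in>p. LINT x|\<nu>. (\<Prod>i\<in>C. g i x))"
  using assms
proof (induction n arbitrary: p)
  case 0
  then have "p = {}" by (simp add: partition_on_empty)
  then show ?case by (simp add: seating_I_def)
next
  case (Suc r)
  note nn = Suc.prems(1) and int = Suc.prems(2)
  obtain P c where P: "partition_on {1..r} P" and c: "c \<in> choices P" and p: "p = seat (Suc r) P c"
    using partition_on_insert_cases[of "Suc r" "{1..r}" p] Suc.prems(3)
    by (auto simp: atLeastAtMostSuc_conv)
  have finP: "finite P" using finite_elements[OF _ P] by simp
  \<comment> \<open>Regroup so that the new normaliser meets the new conditional probability; the
    other pair is the induction hypothesis for \<open>P\<close>.\<close>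
  have "seating_I \<nu> g (Suc r) p * pmf (seating_pmf \<nu> g (Suc r)) p
      = (seat_norm \<nu> g r P * pmf (seating_choice \<nu> g r P) c)
        * (seating_I \<nu> g r P * pmf (seating_pmf \<nu> g r) P)"
    using seating_I_Suc[OF P c, of \<nu> g] pmf_seating_pmf_Suc[where g = g and \<nu> = \<nu>, OF nn P c] p
    by (simp del: seating_pmf.simps)
  also have "seat_norm \<nu> g r P * pmf (seating_choice \<nu> g r P) c = choice_mass \<nu> g (Suc r) c"
    using finP c nn by (intro seat_norm_times_pmf_seating_choice) auto
  also have "seating_I \<nu> g r P * pmf (seating_pmf \<nu> g r) P = (\<Prod>C\<in>P. LINT x|\<nu>. (\<Prod>i\<in>C. g i x))"
    using nn P by (intro Suc.IH int) auto
  also have "choice_mass \<nu> g (Suc r) c * \<dots> = (\<Prod>C\<in>p. LINT x|\<nu>. (\<Prod>i\<in>C. g i x))"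
    unfolding p
  proof (rule prod_seat[symmetric, OF P _ _ c])
    \<comment> \<open>The product over a singleton is the function itself, so its integrability
      yields measurability.\<close>
    show "g (Suc r) \<in> borel_measurable \<nu>" using int[of "{Suc r}"] by simp
    show "integrable \<nu> (\<lambda>x. \<Prod>i\<in>C. g i x)" if "C \<subseteq> {1..r}" "C \<noteq> {}" for C
      using that by (intro int) auto
  qed (use nn in auto)
  finally show ?case .
qed

text \<open>Integrability is required of all products because a Bochner integral that does not exist
  is 0 by convention, which would misstate an infinite mass. The multiplied form of the identity
  also covers partitions along which some normaliser is 0.\<close>

theorem lemma2p3:
  fixes \<nu> :: "'a::polish_space measure"
    and \<Omega> :: "'w measure" and N :: "'w \<Rightarrow> 'a measure"
    and g :: "nat \<Rightarrow> 'a \<Rightarrow> real" and n :: nat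
  assumes "diffuse \<nu>" and "poisson_process \<Omega> N \<nu>"
    and "n \<ge> 1"
    and "\<And>i. i \<in> {1..n} \<Longrightarrow> g i \<in> BM"
    and "\<And>i x. i \<in> {1..n} \<Longrightarrow> 0 \<le> g i x"
    and "\<And>C. C \<subseteq> {1..n} \<Longrightarrow> C \<noteq> {} \<Longrightarrow> integrable \<nu> (\<lambda>x. \<Prod>i\<in>C. g i x)"
  shows "set_pmf (seating_pmf \<nu> g n) \<subseteq> {p. partition_on {1..n} p} \<and>
    (\<forall>p. partition_on {1..n} p \<longrightarrow>
       seating_I \<nu> g n p * pmf (seating_pmf \<nu> g n) p =
         (\<Prod>C\<in>p. LINT x|\<nu>. (\<Prod>i\<in>C. g i x)))"
  using set_pmf_seating_pmf[of n g \<nu>, OF assms(5)]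
    seating_I_times_pmf_seating_pmf[of n g \<nu>, OF assms(5,6)] by blast

end
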